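(* Let $(\varphi_n)_{n\ge 1}$ be an orthonormal system on $[0,1]$, let $p(u)=u$ and $q(u)=1$ for $u\in[0,1]$, and let $x\in G$. Suppose that $p,q\in E(\varphi)$ at the point $x$, i.e. $S_n(x,p)=O(1)$ and $S_n(x,q)=O(1)$ as $n\to\infty$, and that $$M_n(x)=O(1)\quad (n\to\infty).$$ Then for every $f\in C_L$, $$S_n(x,f)=O(1)\quad (n\to\infty).$$
   Context: An orthonormal system (ONS) $(\varphi_n)_{n\ge1}$ on $[0,1]$ is a sequence of real-valued functions, defined (with finite values) at every point of $[0,1]$, which is orthonormal in $L_2=L_2([0,1])$ with respect to Lebesgue measure. $Lip1$ is the class of continuous functions $f$ on $[0,1]$ that are Lipschitz, i.e. $|f(x)-f(y)|=O(h)$ whenever $|x-y|\le h$. $C_L$ is the class of differentiable functions $f$ on $[0,1]$ with $f'\in Lip1$. For $f\in L_2$: $C_n(f)=\int_0^1 f(u)\varphi_n(u)\,du$ and $S_n(x,f)=\sum_{k=1}^n C_k(f)\varphi_k(x)$. $E(\varphi)$ (at the point $x$) is the set of functions $f$ with $|S_n(x,f)|=O(1)$ as $n\to\infty$ at the point $x\in[0,1]$. Put $g_k(u)=\int_0^u\varphi_k(t)\,dt$, $Q_n(u,x)=\sum_{k=1}^n g_k(u)\varphi_k(x)$ and $$M_n(x)=\frac1n\sum_{i=1}^{n-1}\left|\int_0^{i/n}Q_n(u,x)\,du\right|.$$ $G=[0,1]\setminus F$, where $F=\{x\in[0,1]:\limsup_{n\to\infty}\frac1{n^2}\sum_{k=1}^n\varphi_k^2(x)=\infty\}$.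 For a fixed point $x$, $O(1)$ means bounded in $n$ by a constant which may depend on $x$ (and on the function involved). *)

theory Defs
  imports "HOL-Analysis.Analysis" "HOL-Library.Landau_Symbols"
begin

(* Functions on [0,1] are total functions real => real of which only the values on {0..1}
   matter; systems are indexed from 1, so the value at index 0 is never used. *)

definition L2 :: "(real \<Rightarrow> real) set" where
  "L2 = {f. f \<in> borel_measurable (lebesgue_on {0..1}) \<and>
            integrable (lebesgue_on {0..1}) (\<lambda>u. (f u)\<^sup>2)}"

definition orthonormal_system :: "(nat \<Rightarrow> real \<Rightarrow> real) \<Rightarrow> bool" where
  "orthonormal_system \<phi> \<longleftrightarrow>
     (\<forall>n\<ge>1. \<phi> n \<in> L2) \<and>
     (\<forall>m\<ge>1. \<forall>n\<ge>1. (LINT u|lebesgue_on {0..1}. \<phi> m u * \<phi> n u) = (if m = n then 1 else 0))"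

definition Lip1 :: "(real \<Rightarrow> real) set" where
  "Lip1 = {f. continuous_on {0..1} f \<and> (\<exists>L. L-lipschitz_on {0..1} f)}"

(* The derivative is one-sided at the endpoints 0 and 1. *)
definition C_L :: "(real \<Rightarrow> real) set" where
  "C_L = {f. \<exists>f'. (\<forall>u\<in>{0..1}. (f has_real_derivative f' u) (at u within {0..1})) \<and> f' \<in> Lip1}"

definition fourier_coeff :: "(nat \<Rightarrow> real \<Rightarrow> real) \<Rightarrow> nat \<Rightarrow> (real \<Rightarrow> real) \<Rightarrow> real" where
  "fourier_coeff \<phi> n f = (LINT u|lebesgue_on {0..1}. f u * \<phi> n u)"

definition partial_sum :: "(nat \<Rightarrow> real \<Rightarrow> real) \<Rightarrow> nat \<Rightarrow> real \<Rightarrow> (real \<Rightarrow> real) \<Rightarrow> real" where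
  "partial_sum \<phi> n x f = (\<Sum>k=1..n. fourier_coeff \<phi> k f * \<phi> k x)"

definition E_class :: "(nat \<Rightarrow> real \<Rightarrow> real) \<Rightarrow> real \<Rightarrow> (real \<Rightarrow> real) set" where
  "E_class \<phi> x = {f \<in> L2. (\<lambda>n. \<bar>partial_sum \<phi> n x f\<bar>) \<in> O(\<lambda>n. 1)}"

definition prim :: "(nat \<Rightarrow> real \<Rightarrow> real) \<Rightarrow> nat \<Rightarrow> real \<Rightarrow> real" where
  "prim \<phi> k u = (LINT t|lebesgue_on {0..u}. \<phi> k t)"

definition Q :: "(nat \<Rightarrow> real \<Rightarrow> real) \<Rightarrow> nat \<Rightarrow> real \<Rightarrow> real \<Rightarrow> real" where
  "Q \<phi> n u x = (\<Sum>k=1..n. prim \<phi> k u * \<phi> k x)"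

definition M :: "(nat \<Rightarrow> real \<Rightarrow> real) \<Rightarrow> nat \<Rightarrow> real \<Rightarrow> real" where
  "M \<phi> n x =
     1 / real n * (\<Sum>i=1..n-1. \<bar>LINT u|lebesgue_on {0..real i / real n}. Q \<phi> n u x\<bar>)"

definition F_set :: "(nat \<Rightarrow> real \<Rightarrow> real) \<Rightarrow> real set" where
  "F_set \<phi> = {x\<in>{0..1}.
     limsup (\<lambda>n. ereal (1 / (real n)\<^sup>2 * (\<Sum>k=1..n. (\<phi> k x)\<^sup>2))) = \<infinity>}"

definition G_set :: "(nat \<Rightarrow> real \<Rightarrow> real) \<Rightarrow> real set" where
  "G_set \<phi> = {0..1} - F_set \<phi>"

end

theory Submission
  imports Defs
begin

text \<open>
  Let \<open>D\<close> be the kernel with \<open>S\<^sub>n(x, f) = \<integral> f D\<close>, let \<open>Q\<close> be its primitive and \<open>R\<close> the primitive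
  of \<open>Q\<close>.  If \<open>f\<close> were twice continuously differentiable, two integrations by parts would give
  \<open>S\<^sub>n(x, f) = f(1) Q(1) - f'(1) R(1) + \<integral> f'' R\<close>.  Here \<open>Q(1) = S\<^sub>n(x, 1)\<close> and
  \<open>R(1) = S\<^sub>n(x, 1) - S\<^sub>n(x, u)\<close> are bounded by hypothesis, and \<open>\<integral> \<bar>R\<bar>\<close> should be comparable with
  \<open>M\<^sub>n(x)\<close>, the average of \<open>\<bar>R\<bar>\<close> over the points \<open>i / n\<close>.

  For \<open>f'\<close> merely Lipschitz the second integration by parts is replaced by Abel summation on the
  grid of mesh \<open>1 / n\<close> (\<open>integral_summation_by_parts\<close>).  This brings in \<open>M\<^sub>n(x)\<close> directly, since
  the differences of \<open>f'\<close> are at most \<open>L / n\<close>, and costs an error of at most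
  \<open>(L / n) \<integral> \<bar>Q\<bar> \<le> (L / n) \<integral> \<bar>D\<bar>\<close>; see \<open>integral_bound_by_moments_and_grid_average\<close>.
  By orthonormality \<open>\<integral> D\<^sup>2\<close> is the sum of \<open>\<phi>\<^sub>k(x)\<^sup>2\<close> over \<open>k \<le> n\<close>, which is \<open>O(n\<^sup>2)\<close> because
  \<open>x \<in> G\<close>; hence \<open>\<integral> \<bar>D\<bar> = O(n)\<close> (\<open>integral_abs_kernel_le\<close>) and the error is bounded.
\<close>

section \<open>Integration by parts on a uniform grid\<close>

lemma grid_cell_subset:
  assumes "i < m"
  shows "{real i / real m .. real (Suc i) / real m} \<subseteq> {0..1}"
    and "real i / real m \<le> real (Suc i) / real m"
    and "0 \<le> real i / real m" and "real (Suc i) / real m \<le> 1"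
proof -
  show a: "0 \<le> real i / real m" and b: "real (Suc i) / real m \<le> 1"
    and "real i / real m \<le> real (Suc i) / real m"
    using assms by (auto simp: divide_simps)
  show "{real i / real m .. real (Suc i) / real m} \<subseteq> {0..1}"
    using a b by auto
qed

lemma integral_split_grid:
  fixes h :: "real \<Rightarrow> real"
  assumes h: "h integrable_on {0..1}" and m: "0 < m"
  shows "integral {0..1} h = (\<Sum>i<m. integral {real i / real m .. real (Suc i) / real m} h)"
proof -
  have "integral {0..real j / real m} h
      = (\<Sum>i<j. integral {real i / real m .. real (Suc i) / real m} h)" if "j \<le> m" for j
    using that
  proof (induction j)
    case (Suc j)
    have "h integrable_on {0..real (Suc j) / real m}"
      using grid_cell_subset[of j m] Suc.prems by (intro integrable_on_subinterval[OF h]) auto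
    then have "integral {0..real j / real m} h
        + integral {real j / real m .. real (Suc j) / real m} h
        = integral {0..real (Suc j) / real m} h"
      using grid_cell_subset[of j m] Suc.prems
      by (intro Henstock_Kurzweil_Integration.integral_combine) auto
    with Suc show ?case by simp
  qed simp
  from this[of m] m show ?thesis by simp
qed

text \<open>
  Both grid approximations below are made cell by cell, with an error proportional to the mass of
  \<open>h\<close> in the cell; the masses add up over the grid.
\<close>

lemma integral_approx_by_cells:
  fixes p h :: "real \<Rightarrow> real"
  assumes p: "p integrable_on {0..1}" and h: "h absolutely_integrable_on {0..1}" and m: "0 < m"
    and cell: "\<And>i. i < m \<Longrightarrow>
      \<bar>integral {real i / real m .. real (Suc i) / real m} p - a i\<bar>
        \<le> c * integral {real i / real m .. real (Suc i) / real m} (\<lambda>u. \<bar>h u\<bar>)"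
  shows "\<bar>integral {0..1} p - (\<Sum>i<m. a i)\<bar> \<le> c * integral {0..1} (\<lambda>u. \<bar>h u\<bar>)"
proof -
  have h': "(\<lambda>u. \<bar>h u\<bar>) integrable_on {0..1}"
    using h by (auto simp: absolutely_integrable_on_def)
  have "\<bar>integral {0..1} p - (\<Sum>i<m. a i)\<bar>
      = \<bar>\<Sum>i<m. integral {real i / real m .. real (Suc i) / real m} p - a i\<bar>"
    by (simp add: integral_split_grid[OF p m] sum_subtractf)
  also have "\<dots> \<le> (\<Sum>i<m. \<bar>integral {real i / real m .. real (Suc i) / real m} p - a i\<bar>)"
    by (rule sum_abs)
  also have "\<dots> \<le> (\<Sum>i<m. c * integral {real i / real m .. real (Suc i) / real m} (\<lambda>u. \<bar>h u\<bar>))"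
    by (intro sum_mono cell) auto
  also have "\<dots> = c * integral {0..1} (\<lambda>u. \<bar>h u\<bar>)"
    by (simp add: integral_split_grid[OF h' m] sum_distrib_left)
  finally show ?thesis .
qed

lemma integral_interval_diff:
  fixes h :: "real \<Rightarrow> real"
  assumes h: "h integrable_on {0..1}" and "0 \<le> a" "a \<le> b" "b \<le> 1"
  shows "integral {a..b} h = integral {0..b} h - integral {0..a} h"
proof -
  have "h integrable_on {0..b}"
    using assms by (intro integrable_on_subinterval[OF h]) auto
  from Henstock_Kurzweil_Integration.integral_combine[OF assms(2,3) this] show ?thesis by simp
qed

lemma abs_integral_le_integral_abs:
  fixes h :: "real \<Rightarrow> real"
  assumes h: "h absolutely_integrable_on {0..1}" and sub: "{a..b} \<subseteq> {c..d}" "{c..d} \<subseteq> {0..1}"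
  shows "\<bar>integral {a..b} h\<bar> \<le> integral {c..d} (\<lambda>u. \<bar>h u\<bar>)"
proof -
  have i: "h absolutely_integrable_on {a..b}" "h absolutely_integrable_on {c..d}"
    using sub by (auto intro!: absolutely_integrable_on_subinterval[OF h])
  then have "\<bar>integral {a..b} h\<bar> \<le> integral {a..b} (\<lambda>u. \<bar>h u\<bar>)"
    using integral_norm_bound_integral[of h "{a..b}" "\<lambda>u. \<bar>h u\<bar>"]
    by (auto simp: absolutely_integrable_on_def)
  also have "\<dots> \<le> integral {c..d} (\<lambda>u. \<bar>h u\<bar>)"
    using i sub by (intro integral_subset_le) (auto simp: absolutely_integrable_on_def)
  finally show ?thesis .
qed

lemma continuous_times_absolutely_integrable:
  fixes f h :: "real \<Rightarrow> real"
  assumes "continuous_on {0..1} f" and "h absolutely_integrable_on {0..1}"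
  shows "(\<lambda>u. f u * h u) absolutely_integrable_on {0..1}"
  using assms
  by (intro absolutely_integrable_bounded_measurable_product_real
      continuous_imp_measurable_on_sets_lebesgue compact_imp_bounded compact_continuous_image) auto

text \<open>
  On each cell the factor \<open>f\<close> is replaced by its value at the right end point, at a cost of at most
  \<open>L / m\<close> times the mass of \<open>h\<close> in the cell; what remains is a Riemann--Stieltjes sum against
  the primitive of \<open>h\<close>, and Abel summation moves the differences onto \<open>f\<close>.  The error is the
  point of the lemma: whatever the oscillation of \<open>h\<close>, it stays bounded as long as the mesh is at
  most of the order of the inverse of the total mass of \<open>h\<close>.
\<close>

lemma integral_summation_by_parts:
  fixes f h :: "real \<Rightarrow> real"
  assumes f: "L-lipschitz_on {0..1} f" and h: "h absolutely_integrable_on {0..1}" and m: "0 < m"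
  defines "H \<equiv> \<lambda>u. integral {0..u} h"
  shows "\<bar>integral {0..1} (\<lambda>u. f u * h u)
      - (f 1 * H 1
         - (\<Sum>i<m. H (real i / real m) * (f (real (Suc i) / real m) - f (real i / real m))))\<bar>
    \<le> L / real m * integral {0..1} (\<lambda>u. \<bar>h u\<bar>)"
proof -
  let ?t = "\<lambda>i. real i / real m"
  have hi: "h integrable_on {0..1}"
    using h by (simp add: absolutely_integrable_on_def)
  have fh: "(\<lambda>u. f u * h u) absolutely_integrable_on {0..1}"
    using continuous_times_absolutely_integrable[OF lipschitz_on_continuous_on[OF f] h] .
  have "\<bar>integral {0..1} (\<lambda>u. f u * h u) - (\<Sum>i<m. f (?t (Suc i)) * (H (?t (Suc i)) - H (?t i)))\<bar>
      \<le> L / real m * integral {0..1} (\<lambda>u. \<bar>h u\<bar>)"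
  proof (rule integral_approx_by_cells[OF _ h m])
    show "(\<lambda>u. f u * h u) integrable_on {0..1}"
      using fh by (simp add: absolutely_integrable_on_def)
    fix i assume i: "i < m"
    note cell = grid_cell_subset[OF i]
    let ?I = "{?t i..?t (Suc i)}"
    have I: "(\<lambda>u. f u * h u) integrable_on ?I" "h integrable_on ?I" "(\<lambda>u. \<bar>h u\<bar>) integrable_on ?I"
      using absolutely_integrable_on_subinterval[OF fh cell(1)]
        absolutely_integrable_on_subinterval[OF h cell(1)]
      by (auto simp: absolutely_integrable_on_def)
    have "integral ?I (\<lambda>u. f u * h u) - f (?t (Suc i)) * (H (?t (Suc i)) - H (?t i))
        = integral ?I (\<lambda>u. f u * h u) - integral ?I (\<lambda>u. f (?t (Suc i)) * h u)"
      unfolding H_def using integral_interval_diff[OF hi cell(3,2,4)] by simp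
    also have "\<dots> = integral ?I (\<lambda>u. f u * h u - f (?t (Suc i)) * h u)"
      by (intro Henstock_Kurzweil_Integration.integral_diff[symmetric]
          integrable_on_mult_right I)
    finally have eq: "integral ?I (\<lambda>u. f u * h u) - f (?t (Suc i)) * (H (?t (Suc i)) - H (?t i))
        = integral ?I (\<lambda>u. f u * h u - f (?t (Suc i)) * h u)" .
    have "norm (integral ?I (\<lambda>u. f u * h u - f (?t (Suc i)) * h u))
        \<le> integral ?I (\<lambda>u. L / real m * \<bar>h u\<bar>)"
    proof (rule Henstock_Kurzweil_Integration.integral_norm_bound_integral)
      show "(\<lambda>u. f u * h u - f (?t (Suc i)) * h u) integrable_on ?I"
        by (intro Henstock_Kurzweil_Integration.integrable_diff integrable_on_mult_right I)
      show "(\<lambda>u. L / real m * \<bar>h u\<bar>) integrable_on ?I"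
        by (intro integrable_on_mult_right I)
      fix u assume u: "u \<in> ?I"
      have "dist (f u) (f (?t (Suc i))) \<le> L * dist u (?t (Suc i))"
        using cell(1,2) u by (intro lipschitz_onD[OF f] subsetD[OF cell(1)]) auto
      also have "\<dots> \<le> L * (1 / real m)"
        using u by (intro mult_left_mono lipschitz_on_nonneg[OF f])
          (auto simp: dist_real_def add_divide_distrib)
      finally have "\<bar>f u - f (?t (Suc i))\<bar> * \<bar>h u\<bar> \<le> L / real m * \<bar>h u\<bar>"
        by (intro mult_right_mono) (auto simp: dist_real_def)
      then show "norm (f u * h u - f (?t (Suc i)) * h u) \<le> L / real m * \<bar>h u\<bar>"
        unfolding real_norm_def left_diff_distrib[symmetric] abs_mult .
    qed
    then show "\<bar>integral ?I (\<lambda>u. f u * h u) - f (?t (Suc i)) * (H (?t (Suc i)) - H (?t i))\<bar>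
        \<le> L / real m * integral ?I (\<lambda>u. \<bar>h u\<bar>)"
      unfolding eq by simp
  qed
  moreover have "(\<Sum>i<m. f (?t (Suc i)) * (H (?t (Suc i)) - H (?t i)))
      = f 1 * H 1 - (\<Sum>i<m. H (?t i) * (f (?t (Suc i)) - f (?t i)))"
  proof -
    have "(\<Sum>i<m. f (?t (Suc i)) * (H (?t (Suc i)) - H (?t i)))
        + (\<Sum>i<m. H (?t i) * (f (?t (Suc i)) - f (?t i)))
        = (\<Sum>i<m. f (?t (Suc i)) * H (?t (Suc i)) - f (?t i) * H (?t i))"
      unfolding sum.distrib[symmetric]
      by (rule sum.cong[OF refl]) (simp only: algebra_simps add_diff_cancel_left')
    also have "\<dots> = f (?t m) * H (?t m) - f (?t 0) * H (?t 0)"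
      by (rule sum_lessThan_telescope[of "\<lambda>i. f (?t i) * H (?t i)"])
    finally show ?thesis
      using m by (simp add: H_def)
  qed
  ultimately show ?thesis by simp
qed

text \<open>
  The primitive of \<open>h\<close> need not be differentiable everywhere, so this is obtained as the limit of
  \<open>integral_summation_by_parts\<close> on ever finer grids: the sums of \<open>H (f\<^sub>i\<^sub>+\<^sub>1 - f\<^sub>i)\<close> differ from
  \<open>\<integral> f' H\<close> by at most \<open>K / m\<close> times the mass of \<open>h\<close>, where \<open>K\<close> bounds \<open>f'\<close>.
\<close>

lemma integral_by_parts_primitive:
  fixes f f' h :: "real \<Rightarrow> real"
  assumes der: "\<And>u. u \<in> {0..1} \<Longrightarrow> (f has_real_derivative f' u) (at u within {0..1})"
    and f': "continuous_on {0..1} f'" and h: "h absolutely_integrable_on {0..1}"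
  shows "integral {0..1} (\<lambda>u. f u * h u)
    = f 1 * integral {0..1} h - integral {0..1} (\<lambda>u. f' u * integral {0..u} h)"
proof -
  let ?A = "integral {0..1} (\<lambda>u. \<bar>h u\<bar>)"
  define H where "H = (\<lambda>u. integral {0..u} h)"
  have hi: "h integrable_on {0..1}"
    using h by (simp add: absolutely_integrable_on_def)
  have H: "continuous_on {0..1} H"
    unfolding H_def by (rule indefinite_integral_continuous_1[OF hi])
  have f'H: "continuous_on {0..1} (\<lambda>u. f' u * H u)"
    by (intro continuous_intros f' H)
  obtain K where K: "\<And>u. u \<in> {0..1} \<Longrightarrow> \<bar>f' u\<bar> \<le> K"
    using compact_imp_bounded[OF compact_continuous_image[OF f' compact_Icc]]
    unfolding bounded_iff by (metis imageI real_norm_def)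
  have K0: "0 \<le> K"
    using K[of 0] by auto
  have lip: "K-lipschitz_on {0..1} f"
  proof (rule bounded_derivative_imp_lipschitz)
    show "(f has_derivative (*) (f' u)) (at u within {0..1})" if "u \<in> {0..1}" for u
      using der[OF that] by (simp add: has_field_derivative_def)
    show "onorm ((*) (f' u)) \<le> K" if "u \<in> {0..1}" for u
      using K[OF that] by (intro onorm_le) (simp add: abs_mult mult_right_mono)
  qed (use K0 in auto)
  let ?E = "integral {0..1} (\<lambda>u. f u * h u) - (f 1 * H 1 - integral {0..1} (\<lambda>u. f' u * H u))"
  have bound: "\<bar>?E\<bar> \<le> 2 * K * ?A / real m" if m: "0 < m" for m
  proof -
    let ?t = "\<lambda>i. real i / real m"
    have "\<bar>integral {0..1} (\<lambda>u. f' u * H u) - (\<Sum>i<m. H (?t i) * (f (?t (Suc i)) - f (?t i)))\<bar>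
        \<le> K / real m * ?A"
    proof (rule integral_approx_by_cells[OF integrable_continuous_real[OF f'H] h m])
      fix i assume i: "i < m"
      note cell = grid_cell_subset[OF i]
      let ?I = "{?t i..?t (Suc i)}"
      have cont: "continuous_on ?I H" "continuous_on ?I f'"
        using continuous_on_subset[OF _ cell(1)] H f' by auto
      have "(f' has_integral (f (?t (Suc i)) - f (?t i))) ?I"
      proof (rule fundamental_theorem_of_calculus[OF cell(2)])
        fix u assume "u \<in> ?I"
        then show "(f has_vector_derivative f' u) (at u within ?I)"
          unfolding has_real_derivative_iff_has_vector_derivative[symmetric]
          using cell(1) by (intro has_field_derivative_subset[OF der cell(1)]) blast
      qed
      then have "integral ?I (\<lambda>u. f' u * H u) - H (?t i) * (f (?t (Suc i)) - f (?t i))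
          = integral ?I (\<lambda>u. f' u * H u) - integral ?I (\<lambda>u. H (?t i) * f' u)"
        by (simp add: integral_unique)
      also have "\<dots> = integral ?I (\<lambda>u. f' u * H u - H (?t i) * f' u)"
        by (intro Henstock_Kurzweil_Integration.integral_diff[symmetric]
            integrable_continuous_real continuous_intros cont)
      finally have eq: "integral ?I (\<lambda>u. f' u * H u) - H (?t i) * (f (?t (Suc i)) - f (?t i))
          = integral ?I (\<lambda>u. f' u * H u - H (?t i) * f' u)" .
      have "norm (integral ?I (\<lambda>u. f' u * H u - H (?t i) * f' u))
          \<le> (K * integral ?I (\<lambda>u. \<bar>h u\<bar>)) * (?t (Suc i) - ?t i)"
      proof (rule integral_bound[OF cell(2)])
        show "continuous_on ?I (\<lambda>u. f' u * H u - H (?t i) * f' u)"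
          by (intro continuous_intros cont)
        fix u assume u: "u \<in> ?I"
        have "H u - H (?t i) = integral {?t i..u} h"
          unfolding H_def using u cell by (subst integral_interval_diff[OF hi]) auto
        then have "\<bar>H u - H (?t i)\<bar> \<le> integral ?I (\<lambda>u. \<bar>h u\<bar>)"
          using u abs_integral_le_integral_abs[OF h _ cell(1), of "?t i" u] by auto
        then have "\<bar>f' u\<bar> * \<bar>H u - H (?t i)\<bar> \<le> K * integral ?I (\<lambda>u. \<bar>h u\<bar>)"
          using subsetD[OF cell(1) u] by (intro mult_mono K K0) auto
        then show "norm (f' u * H u - H (?t i) * f' u) \<le> K * integral ?I (\<lambda>u. \<bar>h u\<bar>)"
          unfolding real_norm_def mult.commute[of "H (?t i)"] right_diff_distrib[symmetric]
            abs_mult .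
      qed
      then show "\<bar>integral ?I (\<lambda>u. f' u * H u) - H (?t i) * (f (?t (Suc i)) - f (?t i))\<bar>
          \<le> K / real m * integral ?I (\<lambda>u. \<bar>h u\<bar>)"
        unfolding eq by (simp add: add_divide_distrib)
    qed
    moreover have "\<bar>integral {0..1} (\<lambda>u. f u * h u) - (f 1 * H 1 - (\<Sum>i<m. H (?t i) * (f (?t (Suc i)) - f (?t i))))\<bar> \<le> K / real m * ?A"
      unfolding H_def by (rule integral_summation_by_parts[OF lip h m])
    moreover have "\<bar>a - (b - i)\<bar> \<le> \<bar>i - s\<bar> + \<bar>a - (b - s)\<bar>" for a b i s :: real
      by linarith
    ultimately have "\<bar>?E\<bar> \<le> K / real m * ?A + K / real m * ?A"
      by (meson add_mono order_trans)
    then show ?thesis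
      by simp
  qed
  have "\<bar>?E\<bar> \<le> 0"
  proof (rule tendsto_lowerbound)
    show "(\<lambda>m. 2 * K * ?A / real m) \<longlonglongrightarrow> 0"
      by (rule lim_const_over_n)
    show "\<forall>\<^sub>F m in sequentially. \<bar>?E\<bar> \<le> 2 * K * ?A / real m"
      using eventually_gt_at_top[of 0] by eventually_elim (rule bound)
  qed simp
  then show ?thesis
    by (simp add: H_def)
qed

text \<open>
  Integrating by parts once exactly and once on the grid of mesh \<open>1 / n\<close> replaces the (possibly
  nonexistent) second derivative of \<open>f\<close> by first differences of \<open>f'\<close>, each at most \<open>L / n\<close>, so
  that the grid average of \<open>\<bar>R\<bar>\<close> appears.  The boundary value \<open>R 1\<close> is a combination of the
  zeroth and first moments of \<open>h\<close>, by integration by parts with \<open>f u = u\<close>.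
\<close>

lemma integral_bound_by_moments_and_grid_average:
  fixes f f' h :: "real \<Rightarrow> real"
  assumes der: "\<And>u. u \<in> {0..1} \<Longrightarrow> (f has_real_derivative f' u) (at u within {0..1})"
    and f': "L-lipschitz_on {0..1} f'" and h: "h absolutely_integrable_on {0..1}" and n: "0 < n"
  defines "R \<equiv> \<lambda>u. integral {0..u} (\<lambda>v. integral {0..v} h)"
  shows "\<bar>integral {0..1} (\<lambda>u. f u * h u)\<bar>
    \<le> (\<bar>f 1\<bar> + \<bar>f' 1\<bar>) * \<bar>integral {0..1} h\<bar> + \<bar>f' 1\<bar> * \<bar>integral {0..1} (\<lambda>u. u * h u)\<bar>
      + L * (1 / real n * (\<Sum>i=1..n-1. \<bar>R (real i / real n)\<bar>))
      + L / real n * integral {0..1} (\<lambda>u. \<bar>h u\<bar>)"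
proof -
  let ?t = "\<lambda>i. real i / real n"
  let ?A = "integral {0..1} (\<lambda>u. \<bar>h u\<bar>)"
  let ?S = "\<Sum>i<n. R (?t i) * (f' (?t (Suc i)) - f' (?t i))"
  define H where "H = (\<lambda>u. integral {0..u} h)"
  have L0: "0 \<le> L"
    using lipschitz_on_nonneg[OF f'] .
  have hi: "h integrable_on {0..1}"
    using h by (simp add: absolutely_integrable_on_def)
  have H: "continuous_on {0..1} H"
    unfolding H_def by (rule indefinite_integral_continuous_1[OF hi])
  have Ha: "H absolutely_integrable_on {0..1}"
    by (rule absolutely_integrable_continuous_real[OF H])
  \<comment> \<open>\<open>\<bar>H u\<bar>\<close> is at most the total mass of \<open>h\<close>, so the mass of \<open>H\<close> in the error term can be
    replaced by that of \<open>h\<close>\<close>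
  have massH: "integral {0..1} (\<lambda>u. \<bar>H u\<bar>) \<le> ?A"
  proof -
    have "norm (integral {0..1} (\<lambda>u. \<bar>H u\<bar>)) \<le> ?A * (1 - 0)"
      using abs_integral_le_integral_abs[OF h, of 0 _ 0 1]
      by (intro integral_bound continuous_intros H) (auto simp: H_def)
    then show ?thesis by simp
  qed
  have fh: "integral {0..1} (\<lambda>u. f u * h u) = f 1 * H 1 - integral {0..1} (\<lambda>u. f' u * H u)"
    unfolding H_def
    by (rule integral_by_parts_primitive[OF der lipschitz_on_continuous_on[OF f'] h])
  have uh: "integral {0..1} (\<lambda>u. u * h u) = H 1 - R 1"
    using integral_by_parts_primitive[of "\<lambda>u. u" "\<lambda>u. 1" h] h
    by (auto simp: R_def H_def intro!: derivative_eq_intros)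
  have "\<bar>integral {0..1} (\<lambda>u. f' u * H u) - (f' 1 * R 1 - ?S)\<bar>
      \<le> L / real n * integral {0..1} (\<lambda>u. \<bar>H u\<bar>)"
    using integral_summation_by_parts[OF f' Ha n] by (simp add: R_def H_def)
  also have "\<dots> \<le> L / real n * ?A"
    using massH L0 by (intro mult_left_mono) auto
  finally have err: "\<bar>integral {0..1} (\<lambda>u. f' u * H u) - (f' 1 * R 1 - ?S)\<bar> \<le> L / real n * ?A" .
  have "\<bar>?S\<bar> \<le> (\<Sum>i<n. \<bar>R (?t i) * (f' (?t (Suc i)) - f' (?t i))\<bar>)"
    by (rule sum_abs)
  also have "\<dots> \<le> (\<Sum>i<n. L / real n * \<bar>R (?t i)\<bar>)"
  proof (rule sum_mono)
    fix i assume "i \<in> {..<n}"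
    then have "dist (f' (?t (Suc i))) (f' (?t i)) \<le> L * dist (?t (Suc i)) (?t i)"
      using grid_cell_subset[of i n] by (intro lipschitz_onD[OF f']) auto
    then have "\<bar>f' (?t (Suc i)) - f' (?t i)\<bar> \<le> L / real n"
      by (simp add: dist_real_def add_divide_distrib)
    then show "\<bar>R (?t i) * (f' (?t (Suc i)) - f' (?t i))\<bar> \<le> L / real n * \<bar>R (?t i)\<bar>"
      unfolding abs_mult by (subst mult.commute) (intro mult_right_mono, auto)
  qed
  also have "\<dots> = L * (1 / real n * (\<Sum>i<n. \<bar>R (?t i)\<bar>))"
    by (simp add: sum_distrib_left)
  also have "(\<Sum>i<n. \<bar>R (?t i)\<bar>) = (\<Sum>i=1..n-1. \<bar>R (?t i)\<bar>)"
    \<comment> \<open>the summation by parts starts at \<open>i = 0\<close>, the average at \<open>i = 1\<close>, and \<open>R 0 = 0\<close>\<close>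
    by (rule sum.mono_neutral_right) (auto simp: R_def not_le less_Suc_eq)
  finally have S: "\<bar>?S\<bar> \<le> L * (1 / real n * (\<Sum>i=1..n-1. \<bar>R (?t i)\<bar>))" .
  have R1: "\<bar>f' 1 * R 1\<bar> \<le> \<bar>f' 1\<bar> * (\<bar>H 1\<bar> + \<bar>integral {0..1} (\<lambda>u. u * h u)\<bar>)"
    unfolding abs_mult using uh by (intro mult_left_mono) auto
  have tri: "\<bar>p - i\<bar> \<le> \<bar>p\<bar> + \<bar>a\<bar> + \<bar>s\<bar> + \<bar>i - (a - s)\<bar>" for p i a s :: real
    by linarith
  have "\<bar>integral {0..1} (\<lambda>u. f u * h u)\<bar>
    \<le> \<bar>f 1 * H 1\<bar> + \<bar>f' 1 * R 1\<bar> + \<bar>?S\<bar>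
      + \<bar>integral {0..1} (\<lambda>u. f' u * H u) - (f' 1 * R 1 - ?S)\<bar>"
    unfolding fh by (rule tri)
  also have "\<dots> \<le> \<bar>f 1\<bar> * \<bar>H 1\<bar> + \<bar>f' 1\<bar> * (\<bar>H 1\<bar> + \<bar>integral {0..1} (\<lambda>u. u * h u)\<bar>)
      + L * (1 / real n * (\<Sum>i=1..n-1. \<bar>R (?t i)\<bar>)) + L / real n * ?A"
    by (intro add_mono R1 S err) (simp add: abs_mult)
  also have "\<bar>f 1\<bar> * \<bar>H 1\<bar> + \<bar>f' 1\<bar> * (\<bar>H 1\<bar> + \<bar>integral {0..1} (\<lambda>u. u * h u)\<bar>)
      = (\<bar>f 1\<bar> + \<bar>f' 1\<bar>) * \<bar>H 1\<bar> + \<bar>f' 1\<bar> * \<bar>integral {0..1} (\<lambda>u. u * h u)\<bar>"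
    by (simp only: distrib_left distrib_right add.assoc)
  finally show ?thesis
    unfolding H_def .
qed

section \<open>The kernel of the partial sums\<close>

definition partial_sum_kernel :: "(nat \<Rightarrow> real \<Rightarrow> real) \<Rightarrow> nat \<Rightarrow> real \<Rightarrow> real \<Rightarrow> real" where
  "partial_sum_kernel \<phi> n x u = (\<Sum>k=1..n. \<phi> k u * \<phi> k x)"

lemma integrable_lebesgue_on_iff:
  fixes f :: "real \<Rightarrow> real"
  shows "integrable (lebesgue_on {a..b}) f \<longleftrightarrow> f absolutely_integrable_on {a..b}"
  by (simp add: integrable_restrict_space set_integrable_def)

lemma integral_lebesgue_on_eq:
  fixes f :: "real \<Rightarrow> real"
  assumes "f absolutely_integrable_on {a..b}"
  shows "(LINT u|lebesgue_on {a..b}. f u) = integral {a..b} f"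
  using assms by (intro lebesgue_integral_eq_integral) (auto simp: integrable_lebesgue_on_iff)

lemma L2_mult_integrable:
  assumes "f \<in> L2" "g \<in> L2"
  shows "integrable (lebesgue_on {0..1}) (\<lambda>u. f u * g u)"
proof (rule Bochner_Integration.integrable_bound)
  show "integrable (lebesgue_on {0..1}) (\<lambda>u. (f u)\<^sup>2 + (g u)\<^sup>2)"
    using assms by (auto simp: L2_def)
  show "(\<lambda>u. f u * g u) \<in> borel_measurable (lebesgue_on {0..1})"
    using assms by (auto simp: L2_def)
  have "\<bar>a * b\<bar> \<le> a\<^sup>2 + b\<^sup>2" for a b :: real
  proof -
    have "2 * \<bar>a * b\<bar> \<le> a\<^sup>2 + b\<^sup>2"
      using sum_squares_bound[of "\<bar>a\<bar>" "\<bar>b\<bar>"] by (simp add: abs_mult mult.assoc)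
    then show ?thesis
      by (rule order_trans[rotated]) simp
  qed
  then show "AE u in lebesgue_on {0..1}. norm (f u * g u) \<le> norm ((f u)\<^sup>2 + (g u)\<^sup>2)"
    by simp
qed

lemma L2_absolutely_integrable:
  assumes "f \<in> L2"
  shows "f absolutely_integrable_on {0..1}"
proof -
  have "(\<lambda>u. 1) \<in> L2"
    by (simp add: L2_def integrable_lebesgue_on_iff absolutely_integrable_continuous_real)
  from L2_mult_integrable[OF assms this] show ?thesis
    by (simp add: integrable_lebesgue_on_iff)
qed

lemma kernel_absolutely_integrable:
  assumes "\<And>k. k \<ge> 1 \<Longrightarrow> \<phi> k absolutely_integrable_on {0..1}"
  shows "partial_sum_kernel \<phi> n x absolutely_integrable_on {0..1}"
  unfolding partial_sum_kernel_def using assms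
  by (intro absolutely_integrable_sum set_integrable_mult_left) auto

lemma partial_sum_eq_integral_kernel:
  assumes \<phi>: "\<And>k. k \<ge> 1 \<Longrightarrow> \<phi> k absolutely_integrable_on {0..1}" and f: "continuous_on {0..1} f"
  shows "partial_sum \<phi> n x f = integral {0..1} (\<lambda>u. f u * partial_sum_kernel \<phi> n x u)"
proof -
  have a: "(\<lambda>u. f u * \<phi> k u) absolutely_integrable_on {0..1}" if "k \<ge> 1" for k
    by (rule continuous_times_absolutely_integrable[OF f \<phi>[OF that]])
  have "partial_sum \<phi> n x f = (\<Sum>k=1..n. integral {0..1} (\<lambda>u. f u * \<phi> k u * \<phi> k x))"
    unfolding partial_sum_def fourier_coeff_def
    by (intro sum.cong) (auto simp: integral_lebesgue_on_eq[OF a])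
  also have "\<dots> = integral {0..1} (\<lambda>u. \<Sum>k=1..n. f u * \<phi> k u * \<phi> k x)"
    using a by (intro Henstock_Kurzweil_Integration.integral_sum[symmetric] integrable_on_mult_left)
      (auto simp: absolutely_integrable_on_def)
  finally show ?thesis
    by (simp add: partial_sum_kernel_def sum_distrib_left mult.assoc)
qed

lemma Q_eq_primitive_kernel:
  assumes \<phi>: "\<And>k. k \<ge> 1 \<Longrightarrow> \<phi> k absolutely_integrable_on {0..1}" and u: "u \<le> 1"
  shows "Q \<phi> n u x = integral {0..u} (partial_sum_kernel \<phi> n x)"
proof -
  have a: "\<phi> k absolutely_integrable_on {0..u}" if "k \<ge> 1" for k
    using u by (intro absolutely_integrable_on_subinterval[OF \<phi>[OF that]]) auto
  have "Q \<phi> n u x = (\<Sum>k=1..n. integral {0..u} (\<lambda>t. \<phi> k t * \<phi> k x))"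
    unfolding Q_def prim_def by (intro sum.cong) (auto simp: integral_lebesgue_on_eq[OF a])
  also have "\<dots> = integral {0..u} (\<lambda>t. \<Sum>k=1..n. \<phi> k t * \<phi> k x)"
    using a by (intro Henstock_Kurzweil_Integration.integral_sum[symmetric] integrable_on_mult_left)
      (auto simp: absolutely_integrable_on_def)
  finally show ?thesis
    by (simp add: partial_sum_kernel_def[abs_def])
qed

lemma M_eq_grid_average:
  assumes \<phi>: "\<And>k. k \<ge> 1 \<Longrightarrow> \<phi> k absolutely_integrable_on {0..1}"
  shows "M \<phi> n x = 1 / real n * (\<Sum>i=1..n-1.
    \<bar>integral {0..real i / real n} (\<lambda>u. integral {0..u} (partial_sum_kernel \<phi> n x))\<bar>)"
proof -
  have "(LINT u|lebesgue_on {0..real i / real n}. Q \<phi> n u x)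
      = integral {0..real i / real n} (\<lambda>u. integral {0..u} (partial_sum_kernel \<phi> n x))"
    if "i \<in> {1..n-1}" for i
  proof -
    have i: "real i / real n \<le> 1"
      using that by (auto simp: divide_simps)
    have Q: "Q \<phi> n u x = integral {0..u} (partial_sum_kernel \<phi> n x)"
      if "u \<in> {0..real i / real n}" for u
      using that i by (intro Q_eq_primitive_kernel[OF \<phi>]) auto
    have "continuous_on {0..1} (\<lambda>u. integral {0..u} (partial_sum_kernel \<phi> n x))"
      using kernel_absolutely_integrable[OF \<phi>]
      by (intro indefinite_integral_continuous_1) (auto simp: absolutely_integrable_on_def)
    then have "continuous_on {0..real i / real n} (\<lambda>u. Q \<phi> n u x)"
      using Q i by (subst continuous_on_cong[OF refl Q]) (auto elim: continuous_on_subset)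
    then have "(LINT u|lebesgue_on {0..real i / real n}. Q \<phi> n u x)
        = integral {0..real i / real n} (\<lambda>u. Q \<phi> n u x)"
      by (intro integral_lebesgue_on_eq absolutely_integrable_continuous_real)
    also have "\<dots> = integral {0..real i / real n} (\<lambda>u. integral {0..u} (partial_sum_kernel \<phi> n x))"
      using Q by (rule Henstock_Kurzweil_Integration.integral_cong)
    finally show ?thesis .
  qed
  then show ?thesis
    unfolding M_def by simp
qed

text \<open>As a function of \<open>u\<close>, the kernel is the combination of \<open>\<phi>\<^sub>1, \<dots>, \<phi>\<^sub>n\<close> with
  coefficients \<open>\<phi>\<^sub>k(x)\<close>, so this is Parseval's identity.\<close>

lemma integral_kernel_square:
  assumes "orthonormal_system \<phi>"
  shows "integrable (lebesgue_on {0..1}) (\<lambda>u. (partial_sum_kernel \<phi> n x u)\<^sup>2)"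
    and "(LINT u|lebesgue_on {0..1}. (partial_sum_kernel \<phi> n x u)\<^sup>2) = (\<Sum>k=1..n. (\<phi> k x)\<^sup>2)"
proof -
  have sq: "(partial_sum_kernel \<phi> n x u)\<^sup>2
      = (\<Sum>j=1..n. \<Sum>k=1..n. (\<phi> j u * \<phi> k u) * (\<phi> j x * \<phi> k x))" for u
    by (simp add: partial_sum_kernel_def power2_eq_square sum_product mult_ac)
  have int: "integrable (lebesgue_on {0..1}) (\<lambda>u. \<phi> j u * \<phi> k u)" if "j \<ge> 1" "k \<ge> 1" for j k
    using assms that by (intro L2_mult_integrable) (auto simp: orthonormal_system_def)
  show "integrable (lebesgue_on {0..1}) (\<lambda>u. (partial_sum_kernel \<phi> n x u)\<^sup>2)"
    unfolding sq using int by (intro Bochner_Integration.integrable_sum integrable_mult_left) auto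
  have "(LINT u|lebesgue_on {0..1}. (partial_sum_kernel \<phi> n x u)\<^sup>2)
      = (\<Sum>j=1..n. (LINT u|lebesgue_on {0..1}.
          (\<Sum>k=1..n. (\<phi> j u * \<phi> k u) * (\<phi> j x * \<phi> k x))))"
    unfolding sq
    by (rule Bochner_Integration.integral_sum)
      (intro Bochner_Integration.integrable_sum integrable_mult_left int, auto)
  also have "\<dots> = (\<Sum>j=1..n. \<Sum>k=1..n.
      (LINT u|lebesgue_on {0..1}. (\<phi> j u * \<phi> k u) * (\<phi> j x * \<phi> k x)))"
    by (intro sum.cong refl Bochner_Integration.integral_sum integrable_mult_left int) auto
  also have "\<dots> = (\<Sum>j=1..n. \<Sum>k=1..n.
      (LINT u|lebesgue_on {0..1}. \<phi> j u * \<phi> k u) * (\<phi> j x * \<phi> k x))"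
    by (simp only: integral_mult_left_zero)
  also have "\<dots> = (\<Sum>j=1..n. \<Sum>k=1..n. if j = k then (\<phi> j x)\<^sup>2 else 0)"
    using assms by (intro sum.cong refl) (auto simp: orthonormal_system_def power2_eq_square)
  finally show "(LINT u|lebesgue_on {0..1}. (partial_sum_kernel \<phi> n x u)\<^sup>2) = (\<Sum>k=1..n. (\<phi> k x)\<^sup>2)"
    by simp
qed

text \<open>
  The weight \<open>n\<close> in \<open>2 n \<bar>D\<bar> \<le> n\<^sup>2 + D\<^sup>2\<close> is chosen so that both terms have the same order when
  \<open>\<integral> D\<^sup>2 = O(n\<^sup>2)\<close>.
\<close>

lemma integral_abs_kernel_le:
  assumes "orthonormal_system \<phi>" and n: "0 < n"
  shows "integral {0..1} (\<lambda>u. \<bar>partial_sum_kernel \<phi> n x u\<bar>)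
    \<le> real n / 2 * (1 + 1 / (real n)\<^sup>2 * (\<Sum>k=1..n. (\<phi> k x)\<^sup>2))"
proof -
  let ?D = "partial_sum_kernel \<phi> n x"
  have \<phi>: "\<phi> k absolutely_integrable_on {0..1}" if "k \<ge> 1" for k
    using assms(1) that by (auto simp: orthonormal_system_def intro: L2_absolutely_integrable)
  have D: "(\<lambda>u. \<bar>?D u\<bar>) integrable_on {0..1}"
    using kernel_absolutely_integrable[OF \<phi>] by (simp add: absolutely_integrable_on_def)
  have D2: "(\<lambda>u. (?D u)\<^sup>2) absolutely_integrable_on {0..1}"
    using integral_kernel_square(1)[OF assms(1)] by (simp add: integrable_lebesgue_on_iff)
  have D2i: "(\<lambda>u. (?D u)\<^sup>2) integrable_on {0..1}"
    using D2 by (simp add: absolutely_integrable_on_def)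
  have "integral {0..1} (\<lambda>u. \<bar>?D u\<bar>)
      \<le> integral {0..1} (\<lambda>u. real n / 2 + 1 / (2 * real n) * (?D u)\<^sup>2)"
  proof (rule integral_le[OF D])
    show "(\<lambda>u. real n / 2 + 1 / (2 * real n) * (?D u)\<^sup>2) integrable_on {0..1}"
      by (intro Henstock_Kurzweil_Integration.integrable_add integrable_on_mult_right D2i
          integrable_const_ivl)
    show "\<bar>?D u\<bar> \<le> real n / 2 + 1 / (2 * real n) * (?D u)\<^sup>2" for u
      using sum_squares_bound[of "real n" "\<bar>?D u\<bar>"] n
      by (simp add: field_simps power2_eq_square)
  qed
  also have "\<dots> = real n / 2 + 1 / (2 * real n) * integral {0..1} (\<lambda>u. (?D u)\<^sup>2)"
    by (subst Henstock_Kurzweil_Integration.integral_add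
        [OF integrable_const_ivl integrable_on_mult_right[OF D2i]]) simp
  also have "integral {0..1} (\<lambda>u. (?D u)\<^sup>2) = (\<Sum>k=1..n. (\<phi> k x)\<^sup>2)"
    using integral_lebesgue_on_eq[OF D2] integral_kernel_square(2)[OF assms(1)] by simp
  finally show ?thesis
    using n by (simp add: distrib_left power2_eq_square)
qed

lemma G_set_eventually_bounded:
  assumes "x \<in> G_set \<phi>"
  obtains C where "\<forall>\<^sub>F n in sequentially. 1 / (real n)\<^sup>2 * (\<Sum>k=1..n. (\<phi> k x)\<^sup>2) \<le> C"
proof -
  have "limsup (\<lambda>n. ereal (1 / (real n)\<^sup>2 * (\<Sum>k=1..n. (\<phi> k x)\<^sup>2))) < \<infinity>"
    using assms by (auto simp: G_set_def F_set_def)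
  then obtain C where "limsup (\<lambda>n. ereal (1 / (real n)\<^sup>2 * (\<Sum>k=1..n. (\<phi> k x)\<^sup>2))) < ereal C"
    using less_PInf_Ex_of_nat ereal_dense2 by blast
  from Limsup_lessD[OF this] show ?thesis
    by (intro that[of C]) (auto elim: eventually_mono)
qed

text \<open>
  Each of the four terms of \<open>integral_bound_by_moments_and_grid_average\<close>, applied to the kernel,
  is controlled by one of the hypotheses on \<open>x\<close>.
\<close>

theorem theorem1:
  fixes \<phi> :: "nat \<Rightarrow> real \<Rightarrow> real" and x :: real
  assumes "orthonormal_system \<phi>"
    and "x \<in> G_set \<phi>"
    and "(\<lambda>u. u) \<in> E_class \<phi> x"
    and "(\<lambda>u. 1) \<in> E_class \<phi> x"
    and "(\<lambda>n. M \<phi> n x) \<in> O(\<lambda>n. 1)"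
  shows "\<forall>f\<in>C_L. (\<lambda>n. partial_sum \<phi> n x f) \<in> O(\<lambda>n. 1)"
proof
  fix f assume "f \<in> C_L"
  then obtain f' L where der: "\<And>u. u \<in> {0..1} \<Longrightarrow> (f has_real_derivative f' u) (at u within {0..1})"
    and L: "L-lipschitz_on {0..1} f'"
    unfolding C_L_def Lip1_def by blast
  have L0: "0 \<le> L"
    using lipschitz_on_nonneg[OF L] .
  have f: "continuous_on {0..1} f"
    by (rule DERIV_continuous_on[OF der])
  have \<phi>: "\<phi> k absolutely_integrable_on {0..1}" if "k \<ge> 1" for k
    using assms(1) that by (auto simp: orthonormal_system_def intro: L2_absolutely_integrable)
  let ?D = "\<lambda>n. partial_sum_kernel \<phi> n x"
  have D: "?D n absolutely_integrable_on {0..1}" for n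
    by (rule kernel_absolutely_integrable[OF \<phi>])
  have S: "partial_sum \<phi> n x g = integral {0..1} (\<lambda>u. g u * ?D n u)"
    if "continuous_on {0..1} g" for g n
    by (rule partial_sum_eq_integral_kernel[OF \<phi> that])
  have M_eq: "M \<phi> n x = 1 / real n * (\<Sum>i=1..n-1.
      \<bar>integral {0..real i / real n} (\<lambda>u. integral {0..u} (?D n))\<bar>)" for n
    by (rule M_eq_grid_average[OF \<phi>])
  obtain C where C: "\<forall>\<^sub>F n in sequentially. 1 / (real n)\<^sup>2 * (\<Sum>k=1..n. (\<phi> k x)\<^sup>2) \<le> C"
    using G_set_eventually_bounded[OF assms(2)] .
  obtain B1 where B1: "\<forall>\<^sub>F n in sequentially. \<bar>partial_sum \<phi> n x (\<lambda>u. u)\<bar> \<le> B1"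
    using assms(3) by (auto simp: E_class_def elim!: landau_o.bigE)
  obtain B0 where B0: "\<forall>\<^sub>F n in sequentially. \<bar>partial_sum \<phi> n x (\<lambda>u. 1)\<bar> \<le> B0"
    using assms(4) by (auto simp: E_class_def elim!: landau_o.bigE)
  obtain BM where BM: "\<forall>\<^sub>F n in sequentially. \<bar>M \<phi> n x\<bar> \<le> BM"
    using assms(5) by (auto elim!: landau_o.bigE)
  show "(\<lambda>n. partial_sum \<phi> n x f) \<in> O(\<lambda>n. 1)"
  proof (rule bigoI)
    show "\<forall>\<^sub>F n in sequentially. norm (partial_sum \<phi> n x f)
        \<le> ((\<bar>f 1\<bar> + \<bar>f' 1\<bar>) * B0 + \<bar>f' 1\<bar> * B1 + L * BM + L * ((1 + C) / 2)) * norm (1 :: real)"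
      using C B1 B0 BM eventually_gt_at_top[of 0]
    proof eventually_elim
      case (elim n)
      note n = elim(5)
      have "\<bar>integral {0..1} (\<lambda>u. f u * ?D n u)\<bar>
          \<le> (\<bar>f 1\<bar> + \<bar>f' 1\<bar>) * \<bar>integral {0..1} (?D n)\<bar>
            + \<bar>f' 1\<bar> * \<bar>integral {0..1} (\<lambda>u. u * ?D n u)\<bar>
            + L * M \<phi> n x + L / real n * integral {0..1} (\<lambda>u. \<bar>?D n u\<bar>)"
        unfolding M_eq by (rule integral_bound_by_moments_and_grid_average[OF der L D n])
      also have "\<dots> \<le> (\<bar>f 1\<bar> + \<bar>f' 1\<bar>) * B0 + \<bar>f' 1\<bar> * B1 + L * BM + L * ((1 + C) / 2)"
      proof (intro add_mono mult_left_mono)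
        show "\<bar>integral {0..1} (?D n)\<bar> \<le> B0"
          using elim(3) S[of "\<lambda>u. 1" n] by simp
        show "\<bar>integral {0..1} (\<lambda>u. u * ?D n u)\<bar> \<le> B1"
          using elim(2) S[of "\<lambda>u. u" n] by simp
        show "M \<phi> n x \<le> BM"
          using elim(4) by simp
        have "integral {0..1} (\<lambda>u. \<bar>?D n u\<bar>) \<le> real n / 2 * (1 + C)"
          by (rule order_trans[OF integral_abs_kernel_le[OF assms(1) n] mult_left_mono])
            (use elim(1) in auto)
        then have "L / real n * integral {0..1} (\<lambda>u. \<bar>?D n u\<bar>)
            \<le> L / real n * (real n / 2 * (1 + C))"
          using L0 by (intro mult_left_mono) auto
        then show "L / real n * integral {0..1} (\<lambda>u. \<bar>?D n u\<bar>) \<le> L * ((1 + C) / 2)"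
          using n by simp
      qed (use L0 in auto)
      finally show ?case
        unfolding S[OF f] real_norm_def by simp
    qed
  qed
qed

end
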